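(* Let $i\in N_4=\{1,2,3,4\}$, let $\mathbf r$ be the rank function of $\hat U^i_{2,5}$, and let $a\ge 0$ be a real number. Then $\mathbf h=a\mathbf r$ is entropic if and only if $a=\log v$ for some integer $v\ge 1$.
   Context: $N_4=\{1,2,3,4\}$. A set function $\mathbf h:2^{N_4}\to\mathbb R$ is called entropic if there is a random vector $(X_1,X_2,X_3,X_4)$, each $X_i$ taking values in a finite set, with $\mathbf h(A)=H(X_A)$ for all $A\subseteq N_4$, where $H$ is Shannon entropy, $X_A=(X_j,j\in A)$ and $\mathbf h(\emptyset)=0$. Logarithms (also in the entropy) are to base $2$. For $i\in N_4$, $\hat U^i_{2,5}$ is the integer polymatroid on $N_4$ with rank function $\mathbf r(A)=\min\{2,|A|\}$ for $A\neq\{i\}$ and $\mathbf r(\{i\})=2$. *)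

theory Defs
  imports "HOL-Probability.Probability"
begin

definition N4 :: "nat set" where
  "N4 = {1, 2, 3, 4}"

definition U25_hat_rank :: "nat \<Rightarrow> nat set \<Rightarrow> nat" where
  "U25_hat_rank i A = (if A = {i} then 2 else min 2 (card A))"

(* simple_function M (X i) says that X i is measurable and has finite range. *)
definition finite_random_vector :: "'w measure \<Rightarrow> (nat \<Rightarrow> 'w \<Rightarrow> 'x) \<Rightarrow> bool" where
  "finite_random_vector M X \<longleftrightarrow> prob_space M \<and> (\<forall>i\<in>N4. simple_function M (X i))"

definition subvector :: "(nat \<Rightarrow> 'w \<Rightarrow> 'x) \<Rightarrow> nat set \<Rightarrow> 'w \<Rightarrow> (nat \<Rightarrow> 'x)" where
  "subvector X A \<omega> = (\<lambda>j\<in>A. X j \<omega>)"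

(* Entropy relative to the counting measure on the range, i.e. what the locale
   information_space abbreviates as \<H>(subvector X A) for base 2. *)
definition entropy_function :: "'w measure \<Rightarrow> (nat \<Rightarrow> 'w \<Rightarrow> 'x) \<Rightarrow> nat set \<Rightarrow> real" where
  "entropy_function M X A =
     prob_space.entropy M 2 (count_space (subvector X A ` space M)) (subvector X A)"

(* HOL cannot quantify over types inside a formula, so the sample space and the alphabets
   are subsets of nat. This is no restriction: see entropicI below. *)
definition entropic :: "(nat set \<Rightarrow> real) \<Rightarrow> bool" where
  "entropic h \<longleftrightarrow> (\<exists>(M :: nat measure) (X :: nat \<Rightarrow> nat \<Rightarrow> nat).
     finite_random_vector M X \<and> (\<forall>A. A \<subseteq> N4 \<longrightarrow> h A = entropy_function M X A))"

lemma finite_N4: "finite N4"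
  by (simp add: N4_def)

lemma simple_function_subvector:
  assumes "finite_random_vector M X" "A \<subseteq> N4"
  shows "simple_function M (subvector X A)"
proof -
  have s: "simple_function M (X j)" if "j \<in> A" for j
    using assms that by (auto simp: finite_random_vector_def)
  have fA: "finite A"
    using assms(2) finite_N4 finite_subset by blast
  have "subvector X A ` space M \<subseteq> (\<Pi>\<^sub>E j\<in>A. X j ` space M)"
    by (auto simp: subvector_def)
  moreover have "finite (\<Pi>\<^sub>E j\<in>A. X j ` space M)"
    using s fA by (intro finite_PiE) (auto simp: simple_function_def)
  ultimately have fin: "finite (subvector X A ` space M)"
    using finite_subset by blast
  have "subvector X A -` {y} \<inter> space M \<in> sets M" if "y \<in> subvector X A ` space M" for y
  proof -
    from that have ext: "y \<in> extensional A"
      by (auto simp: subvector_def)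
    have "subvector X A -` {y} \<inter> space M = {\<omega> \<in> space M. \<forall>j\<in>A. X j \<omega> = y j}"
      using ext by (auto simp: subvector_def fun_eq_iff extensional_def restrict_def)
    also have "\<dots> \<in> sets M"
    proof (rule sets.sets_Collect_finite_All[OF _ fA])
      fix j assume "j \<in> A"
      then have "X j -` {y j} \<inter> space M \<in> sets M"
        using s by (rule_tac simple_functionD(2)) auto
      also have "X j -` {y j} \<inter> space M = {\<omega> \<in> space M. X j \<omega> = y j}"
        by auto
      finally show "{\<omega> \<in> space M. X j \<omega> = y j} \<in> sets M" .
    qed
    finally show ?thesis .
  qed
  with fin show ?thesis
    by (auto simp: simple_function_def)
qed

(* Random vectors over arbitrary probability spaces and with arbitrary alphabets
   give entropic functions. *)
lemma entropicI:
  fixes M :: "'w measure" and X :: "nat \<Rightarrow> 'w \<Rightarrow> 'x"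
  assumes X: "finite_random_vector M X"
    and h: "\<And>A. A \<subseteq> N4 \<Longrightarrow> h A = entropy_function M X A"
  shows "entropic h"
proof -
  interpret information_space M 2
    using X by (simp add: information_space_def information_space_axioms_def finite_random_vector_def)
  define J where "J = subvector X N4 ` space M"
  have sJ: "simple_function M (subvector X N4)"
    by (rule simple_function_subvector[OF X]) simp
  then have fJ: "finite J"
    by (simp add: J_def simple_function_def)
  define V where "V = (\<Union>j\<in>N4. X j ` space M)"
  have fV: "finite V"
    unfolding V_def using X finite_N4
    by (intro finite_UN_I) (auto simp: finite_random_vector_def simple_function_def)
  obtain g :: "(nat \<Rightarrow> 'x) \<Rightarrow> nat" where g: "inj_on g J"
    using finite_imp_inj_to_nat_seg[OF fJ] by blast
  obtain e :: "'x \<Rightarrow> nat" where e: "inj_on e V"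
    using finite_imp_inj_to_nat_seg[OF fV] by blast
  define T where "T = (\<lambda>\<omega>. g (subvector X N4 \<omega>))"
  define S where "S = T ` space M"
  define M' where "M' = distr M (count_space S) T"
  define X' where "X' = (\<lambda>j n. e (inv_into J g n j))"
  have "simple_function M T"
    using simple_function_compose[OF sJ, of g] by (simp add: T_def comp_def)
  then have fS: "finite S" and "\<And>n. T -` {n} \<inter> space M \<in> sets M"
    by (simp_all add: S_def simple_functionD)
  then have T: "T \<in> measurable M (count_space S)"
    by (subst measurable_count_space_eq2) (auto simp: S_def)
  have space: "space M' = S" and sets: "sets M' = Pow S"
    by (simp_all add: M'_def)
  have X'T: "X' j (T \<omega>) = e (X j \<omega>)" if "j \<in> N4" "\<omega> \<in> space M" for j \<omega>
    using that g by (simp add: X'_def T_def inv_into_f_f J_def subvector_def)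
  have fin': "finite_random_vector M' X'"
    using prob_space_distr[OF T] fS
    by (auto simp: finite_random_vector_def simple_function_def space sets M'_def[symmetric])
  have "h A = entropy_function M' X' A" if A: "A \<subseteq> N4" for A
  proof -
    interpret M': prob_space M'
      using fin' by (simp add: finite_random_vector_def)
    define \<phi> where "\<phi> = (\<lambda>y :: nat \<Rightarrow> 'x. \<lambda>j\<in>A. e (y j))"
    have comp: "subvector X' A (T \<omega>) = (\<phi> \<circ> subvector X A) \<omega>" if "\<omega> \<in> space M" for \<omega>
      using that A X'T by (auto simp: subvector_def \<phi>_def fun_eq_iff)
    have inj: "inj_on \<phi> (subvector X A ` space M)"
    proof (rule inj_onI, clarify)
      fix u v assume uv: "u \<in> space M" "v \<in> space M" "\<phi> (subvector X A u) = \<phi> (subvector X A v)"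
      have "X j u = X j v" if "j \<in> A" for j
      proof -
        have "e (X j u) = e (X j v)"
          using fun_cong[OF uv(3), of j] that by (simp add: \<phi>_def subvector_def)
        moreover have "X j u \<in> V" "X j v \<in> V"
          using that A uv by (auto simp: V_def)
        ultimately show ?thesis
          using e by (auto dest: inj_onD)
      qed
      then show "subvector X A u = subvector X A v"
        by (auto simp: subvector_def fun_eq_iff)
    qed
    have img: "subvector X' A ` space M' = (\<phi> \<circ> subvector X A) ` space M"
      unfolding space S_def image_image using comp by (auto simp: image_iff)
    have "distr M' (count_space (subvector X' A ` space M')) (subvector X' A)
        = distr M (count_space (subvector X' A ` space M')) (subvector X' A \<circ> T)"
      unfolding M'_def by (rule distr_distr[OF _ T]) auto
    also have "\<dots> = distr M (count_space (subvector X' A ` space M')) (\<phi> \<circ> subvector X A)"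
      by (rule distr_cong) (auto simp: comp)
    finally have "entropy_function M' X' A
        = entropy 2 (count_space ((\<phi> \<circ> subvector X A) ` space M)) (\<phi> \<circ> subvector X A)"
      by (simp add: entropy_function_def entropy_def M'.entropy_def img)
    also have "\<dots> = entropy 2 (count_space (subvector X A ` space M)) (subvector X A)"
      by (rule entropy_of_inj[OF simple_function_subvector[OF X A] inj])
    also have "\<dots> = h A"
      by (simp add: h[OF A] entropy_function_def)
    finally show ?thesis ..
  qed
  with fin' show ?thesis
    unfolding entropic_def by blast
qed

end

theory Submission
  imports Defs
begin

text \<open>
  Only the three variables other than \<open>X\<^sub>i\<close> matter for necessity. If \<open>X, Y, Z\<close> each have entropy \<open>a\<close>,
  and every two of them, as well as all three, have joint entropy \<open>2a\<close>, then they are pairwise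
  independent and each is a function of the other two. Hence, for \<open>x, y\<close> of positive probability,
  there is \<open>z\<close> with \<open>P(x,y,z) = P(x)P(y) = P(x)P(z) = P(y)P(z)\<close>, so \<open>P(x) = P(y)\<close>: the variable \<open>X\<close>
  is uniform on its support. Conversely take \<open>X, Y\<close> independent and uniform on \<open>\<int>/n\<close>,
  \<open>Z = X + Y\<close> and \<open>X\<^sub>i = (X, Y)\<close>.
\<close>

section \<open>Entropy of finite-valued random variables\<close>

text \<open>The bound \<open>ln t \<le> t - 1\<close>, with equality only at \<open>t = 1\<close>,
  taken at \<open>t = q x / p x\<close> makes each
  \<open>q x - p x - p x * (ln (q x) - ln (p x))\<close> nonnegative. The assumptions bound their
  sum by 0, so each one vanishes. As \<open>ln 0 = 0\<close> in HOL, absolute continuity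
  \<open>ac\<close> has to exclude points with \<open>q x = 0 < p x\<close>.\<close>

lemma Gibbs_equality:
  fixes p q :: "'a \<Rightarrow> real"
  assumes "finite S" and p: "\<And>x. x \<in> S \<Longrightarrow> 0 \<le> p x" and q: "\<And>x. x \<in> S \<Longrightarrow> 0 \<le> q x"
    and ac: "\<And>x. x \<in> S \<Longrightarrow> q x = 0 \<Longrightarrow> p x = 0"
    and sum: "sum q S \<le> sum p S"
    and eq: "(\<Sum>x\<in>S. p x * (ln (q x) - ln (p x))) \<ge> 0"
    and "x \<in> S"
  shows "p x = q x"
proof -
  let ?d = "\<lambda>x. q x - p x - p x * (ln (q x) - ln (p x))"
  have d: "0 \<le> ?d y" "?d y = 0 \<Longrightarrow> p y = q y" if "y \<in> S" for y
  proof -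
    have "0 \<le> ?d y \<and> (?d y = 0 \<longrightarrow> p y = q y)"
    proof (cases "p y = 0")
      case True
      then show ?thesis using q[OF that] by simp
    next
      case False
      then have pos: "p y > 0" "q y > 0"
        using p[OF that] q[OF that] ac[OF that] by force+
      have "?d y = p y * (q y / p y - 1 - ln (q y / p y))"
        using pos by (simp add: ln_div field_simps)
      moreover have "ln (q y / p y) \<le> q y / p y - 1"
        using pos by (intro ln_le_minus_one) simp
      moreover have "p y = q y" if "ln (q y / p y) = q y / p y - 1"
        using ln_eq_minus_one[OF _ that] pos by simp
      ultimately show ?thesis
        using pos by auto
    qed
    then show "0 \<le> ?d y" "?d y = 0 \<Longrightarrow> p y = q y" by auto
  qed
  have "sum ?d S \<le> 0"
    using sum eq by (simp add: sum_subtractf)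
  then have "sum ?d S = 0"
    using d(1) by (intro antisym sum_nonneg)
  then have "?d x = 0"
    using sum_nonneg_eq_0_iff[of S ?d] d(1) \<open>finite S\<close> \<open>x \<in> S\<close> by blast
  then show ?thesis using d(2) \<open>x \<in> S\<close> by blast
qed

section \<open>Point masses and marginal distributions\<close>

abbreviation (in prob_space) mass :: "('a \<Rightarrow> 'b) \<Rightarrow> 'b \<Rightarrow> real" where
  "mass X x \<equiv> prob {\<omega> \<in> space M. X \<omega> = x}"

lemma (in prob_space) simple_function_Collect_sets:
  assumes "simple_function M X"
  shows "{\<omega> \<in> space M. P (X \<omega>)} \<in> events"
proof -
  have "X -` {x. P x} \<inter> space M \<in> events"
    by (rule simple_functionD(2)[OF assms])
  then show ?thesis by (simp add: vimage_def Int_def conj_commute)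
qed

lemma (in prob_space) mass_comp:
  assumes T: "simple_function M T" and "finite S" and S: "T ` space M \<subseteq> S"
  shows "mass (\<lambda>\<omega>. f (T \<omega>)) x = (\<Sum>t | t \<in> S \<and> f t = x. mass T t)"
proof -
  have "{\<omega> \<in> space M. f (T \<omega>) = x} = (\<Union>t\<in>{t \<in> S. f t = x}. {\<omega> \<in> space M. T \<omega> = t})"
    using S by auto
  then have "mass (\<lambda>\<omega>. f (T \<omega>)) x = prob (\<Union>t\<in>{t \<in> S. f t = x}. {\<omega> \<in> space M. T \<omega> = t})"
    by simp
  also have "\<dots> = (\<Sum>t | t \<in> S \<and> f t = x. mass T t)"
    using \<open>finite S\<close> simple_function_Collect_sets[OF T]
    by (intro finite_measure_finite_Union) (auto simp: disjoint_family_on_def)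
  finally show ?thesis .
qed

text \<open>Change of variables, by grouping the points of \<open>S\<close> into the fibres of
  \<open>f\<close>. It turns marginal entropies into sums over the joint range, where they can be
  compared term by term.\<close>

lemma (in prob_space) sum_mass_comp:
  assumes T: "simple_function M T" and "finite S" and S: "T ` space M \<subseteq> S"
    and "finite R" and R: "f ` S \<subseteq> R"
  shows "(\<Sum>x\<in>R. mass (\<lambda>\<omega>. f (T \<omega>)) x * g x) = (\<Sum>t\<in>S. mass T t * g (f t))"
proof -
  have "(\<Sum>x\<in>R. mass (\<lambda>\<omega>. f (T \<omega>)) x * g x)
      = (\<Sum>x\<in>R. \<Sum>t | t \<in> S \<and> f t = x. mass T t * g (f t))"
    by (intro sum.cong) (auto simp: mass_comp[OF T \<open>finite S\<close> S] sum_distrib_right)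
  also have "\<dots> = (\<Sum>t\<in>S. mass T t * g (f t))"
    by (rule sum.group[OF \<open>finite S\<close> \<open>finite R\<close> R])
  finally show ?thesis .
qed

lemma (in prob_space) sum_mass:
  assumes "simple_function M T" "finite S" "T ` space M \<subseteq> S"
  shows "(\<Sum>t\<in>S. mass T t) = 1"
  \<comment> \<open>The constant map to \<open>()\<close> has a single fibre, of probability
    1.\<close>
  using sum_mass_comp[OF assms, of "{()}" "\<lambda>_. ()" "\<lambda>_. 1"]
  by (simp add: prob_space image_subset_iff)

lemma (in prob_space) mass_nonzero_imp_mem:
  assumes "mass X x \<noteq> 0"
  shows "x \<in> X ` space M"
proof (rule ccontr)
  assume "x \<notin> X ` space M"
  then have "{\<omega> \<in> space M. X \<omega> = x} = {}" by auto
  with assms show False by simp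
qed

section \<open>Entropy in terms of point masses, and two equality cases\<close>

context information_space
begin

text \<open>Points outside the range have mass 0 and contribute nothing. The freedom in
  \<open>S\<close> allows products of ranges.\<close>

lemma entropy_superset:
  assumes X: "simple_function M X" and "finite S" and S: "X ` space M \<subseteq> S"
  shows "\<H>(X) = - (\<Sum>x\<in>S. mass X x * log b (mass X x))"
proof -
  have "simple_distributed M X (mass X)"
    using X by (rule simple_distributedI) (auto intro!: arg_cong[where f=prob])
  then have "\<H>(X) = - (\<Sum>x\<in>X ` space M. mass X x * log b (mass X x))"
    by (rule entropy_simple_distributed)
  also have "(\<Sum>x\<in>X ` space M. mass X x * log b (mass X x))
      = (\<Sum>x\<in>S. mass X x * log b (mass X x))"
    using \<open>finite S\<close> S mass_nonzero_imp_mem[of X] by (intro sum.mono_neutral_left) auto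
  finally show ?thesis .
qed

lemma entropy_constant_mass:
  assumes X: "simple_function M X"
    and c: "\<And>x. x \<in> X ` space M \<Longrightarrow> mass X x \<noteq> 0 \<Longrightarrow> mass X x = c"
  shows "\<H>(X) = - log b c"
proof -
  note fin = simple_functionD(1)[OF X]
  have "\<H>(X) = - (\<Sum>x\<in>X ` space M. mass X x * log b (mass X x))"
    by (rule entropy_superset[OF X fin]) simp
  also have "\<dots> = - (\<Sum>x\<in>X ` space M. mass X x * log b c)"
  proof (intro arg_cong[where f=uminus] sum.cong refl)
    fix x assume "x \<in> X ` space M"
    then show "mass X x * log b (mass X x) = mass X x * log b c"
      using c[of x] by (cases "mass X x = 0") simp_all
  qed
  also have "\<dots> = - log b c"
    by (simp add: sum_distrib_right[symmetric] sum_mass[OF X fin])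
  finally show ?thesis .
qed

text \<open>The fibre of \<open>f\<close> through \<open>t\<close> has at least the mass of
  \<open>t\<close>, so \<H>(T) - \<H>(f(T)) is a sum of nonnegative terms. If it is 0, each term is
  0: up to null sets, \<open>f (T \<omega>)\<close> determines \<open>T \<omega>\<close>.\<close>

lemma mass_eq_if_entropy_comp_eq:
  assumes T: "simple_function M T" and eq: "\<H>(\<lambda>\<omega>. f (T \<omega>)) = \<H>(T)"
    and pos: "mass T t \<noteq> 0"
  shows "mass (\<lambda>\<omega>. f (T \<omega>)) (f t) = mass T t"
proof -
  let ?S = "T ` space M" and ?q = "\<lambda>t. mass (\<lambda>\<omega>. f (T \<omega>)) (f t)"
  note fin = simple_functionD(1)[OF T]
  have fT: "simple_function M (\<lambda>\<omega>. f (T \<omega>))"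
    using simple_function_compose[OF T, of f] by (simp add: comp_def)
  have "\<H>(\<lambda>\<omega>. f (T \<omega>))
      = - (\<Sum>x\<in>f ` ?S. mass (\<lambda>\<omega>. f (T \<omega>)) x * log b (mass (\<lambda>\<omega>. f (T \<omega>)) x))"
    using fin by (intro entropy_superset[OF fT]) auto
  also have "\<dots> = - (\<Sum>t\<in>?S. mass T t * log b (?q t))"
    using fin by (subst sum_mass_comp[OF T fin]) auto
  finally have "(\<Sum>t\<in>?S. mass T t * (log b (?q t) - log b (mass T t))) = 0"
    using eq entropy_superset[OF T fin] by (simp add: right_diff_distrib sum_subtractf)
  moreover have "0 \<le> mass T t * (log b (?q t) - log b (mass T t))" for t
  proof (cases "mass T t = 0")
    case False
    then have "0 < mass T t" by (simp add: zero_less_measure_iff)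
    moreover have "mass T t \<le> ?q t"
      using simple_function_Collect_sets[OF T, of "\<lambda>s. f s = f t"]
      by (intro finite_measure_mono) auto
    ultimately show ?thesis using b_gt_1 by simp
  qed simp
  ultimately have "mass T t * (log b (?q t) - log b (mass T t)) = 0" if "t \<in> ?S" for t
    using fin that by (subst (asm) sum_nonneg_eq_0_iff) auto
  from this[OF mass_nonzero_imp_mem[OF pos]] have log: "log b (?q t) = log b (mass T t)"
    using pos unfolding mult_eq_0_iff right_minus_eq by blast
  have "0 < mass T t" using pos by (simp add: zero_less_measure_iff)
  moreover have "mass T t \<le> ?q t"
    using simple_function_Collect_sets[OF T, of "\<lambda>s. f s = f t"]
    by (intro finite_measure_mono) auto
  ultimately have "0 < ?q t" by (rule less_le_trans)
  with \<open>0 < mass T t\<close> show ?thesis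
    using inj_onD[OF log_inj[OF b_gt_1] log] by (simp only: greaterThan_iff)
qed

text \<open>Additivity says that the mutual information is 0. This is the equality case of the Gibbs
  inequality for the joint distribution against the product of its marginals.\<close>

lemma mass_Pair_if_entropy_additive:
  assumes X: "simple_function M X" and Y: "simple_function M Y"
    and eq: "\<H>(\<lambda>\<omega>. (X \<omega>, Y \<omega>)) = \<H>(X) + \<H>(Y)"
  shows "mass (\<lambda>\<omega>. (X \<omega>, Y \<omega>)) (x, y) = mass X x * mass Y y"
proof -
  define T where "T = (\<lambda>\<omega>. (X \<omega>, Y \<omega>))"
  define S where "S = X ` space M \<times> Y ` space M"
  have T: "simple_function M T"
    unfolding T_def by (rule simple_function_Pair[OF X Y])
  have fX: "finite (X ` space M)" and fY: "finite (Y ` space M)"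
    using X Y by (auto dest: simple_functionD)
  have fS: "finite S" and TS: "T ` space M \<subseteq> S"
    using fX fY by (auto simp: S_def T_def)
  have le: "mass T t \<le> mass X (fst t)" "mass T t \<le> mass Y (snd t)" for t
    using simple_function_Collect_sets[OF X, of "\<lambda>x. x = fst t"]
      simple_function_Collect_sets[OF Y, of "\<lambda>y. y = snd t"]
    by (auto simp: T_def intro!: finite_measure_mono)
  have HX: "\<H>(X) = - (\<Sum>t\<in>S. mass T t * log b (mass X (fst t)))"
    using sum_mass_comp[OF T fS TS fX, of fst "\<lambda>x. log b (mass X x)"]
    by (simp add: entropy_superset[OF X fX] S_def T_def)
  have HY: "\<H>(Y) = - (\<Sum>t\<in>S. mass T t * log b (mass Y (snd t)))"
    using sum_mass_comp[OF T fS TS fY, of snd "\<lambda>y. log b (mass Y y)"]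
    by (simp add: entropy_superset[OF Y fY] S_def T_def)
  \<comment> \<open>Splitting the logarithm of the product needs positive marginals. These are
    guaranteed where the joint mass is positive; elsewhere both sides are 0.\<close>
  have "(\<Sum>t\<in>S. mass T t * (ln (mass X (fst t) * mass Y (snd t)) - ln (mass T t)))
      = ln b * (\<Sum>t\<in>S. mass T t * log b (mass X (fst t)) + mass T t * log b (mass Y (snd t))
           - mass T t * log b (mass T t))"
    unfolding sum_distrib_left
  proof (intro sum.cong refl)
    fix t
    show "mass T t * (ln (mass X (fst t) * mass Y (snd t)) - ln (mass T t))
      = ln b * (mass T t * log b (mass X (fst t)) + mass T t * log b (mass Y (snd t))
           - mass T t * log b (mass T t))"
    proof (cases "mass T t = 0")
      case False
      then have "0 < mass T t" by (simp add: zero_less_measure_iff)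
      with le[of t] have "0 < mass X (fst t)" "0 < mass Y (snd t)" by linarith+
      then show ?thesis
        using b_gt_1 by (simp add: ln_mult log_def field_simps)
    qed simp
  qed
  also have "\<dots> = ln b * (- \<H>(X) - \<H>(Y) + \<H>(T))"
    by (simp only: HX HY entropy_superset[OF T fS TS]) (simp add: sum_subtractf sum.distrib)
  also have "\<dots> = 0"
    using eq by (simp add: T_def)
  finally have zero:
    "(\<Sum>t\<in>S. mass T t * (ln (mass X (fst t) * mass Y (snd t)) - ln (mass T t))) = 0" .
  have "(\<Sum>t\<in>S. mass X (fst t) * mass Y (snd t)) = 1"
    by (simp add: S_def sum.cartesian_product' sum_distrib_left[symmetric] sum_mass[OF Y fY] sum_mass[OF X fX])
  then have sums: "(\<Sum>t\<in>S. mass X (fst t) * mass Y (snd t)) \<le> (\<Sum>t\<in>S. mass T t)"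
    by (simp add: sum_mass[OF T fS TS])
  show ?thesis
  proof (cases "(x, y) \<in> S")
    case True
    have "mass T (x, y) = mass X (fst (x, y)) * mass Y (snd (x, y))"
    proof (rule Gibbs_equality[OF fS _ _ _ sums _ True])
      show "mass T t = 0" if "mass X (fst t) * mass Y (snd t) = 0" for t
      proof -
        have "mass X (fst t) = 0 \<or> mass Y (snd t) = 0" using that by simp
        then have "mass T t \<le> 0" using le[of t] by linarith
        then show ?thesis by (simp add: measure_le_0_iff)
      qed
    qed (use zero in auto)
    then show ?thesis by (simp add: T_def)
  next
    \<comment> \<open>Outside the product of the ranges, the joint mass and one of the marginals are
      both 0.\<close>
    case False
    then have "mass X x = 0 \<or> mass Y y = 0"
      using mass_nonzero_imp_mem[of X x] mass_nonzero_imp_mem[of Y y] by (auto simp: S_def)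
    moreover have "mass T (x, y) = 0"
      using False TS mass_nonzero_imp_mem[of T "(x, y)"] by auto
    ultimately show ?thesis by (auto simp: T_def)
  qed
qed

section \<open>Three variables, any two of which determine the third\<close>

text \<open>\<open>X\<close> turns out to be uniform on its support, and \<open>n\<close> is the
  size of the support.\<close>

lemma entropy_eq_log_nat:
  assumes X: "simple_function M X" and Y: "simple_function M Y" and Z: "simple_function M Z"
    and HY: "\<H>(Y) = \<H>(X)" and HZ: "\<H>(Z) = \<H>(X)"
    and XY: "\<H>(\<lambda>\<omega>. (X \<omega>, Y \<omega>)) = 2 * \<H>(X)"
    and XZ: "\<H>(\<lambda>\<omega>. (X \<omega>, Z \<omega>)) = 2 * \<H>(X)"
    and YZ: "\<H>(\<lambda>\<omega>. (Y \<omega>, Z \<omega>)) = 2 * \<H>(X)"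
    and XYZ: "\<H>(\<lambda>\<omega>. (X \<omega>, Y \<omega>, Z \<omega>)) = 2 * \<H>(X)"
  shows "\<exists>n\<ge>1. \<H>(X) = log b (real n)"
proof -
  let ?T = "\<lambda>\<omega>. (X \<omega>, Y \<omega>, Z \<omega>)"
  have T: "simple_function M ?T"
    by (intro simple_function_Pair X Y Z)
  have same: "mass X x = mass Y y" if "mass X x \<noteq> 0" "mass Y y \<noteq> 0" for x y
  proof -
    let ?S = "?T ` space M"
    have fS: "finite ?S" by (rule simple_functionD(1)[OF T])
    have pxy: "mass (\<lambda>\<omega>. (X \<omega>, Y \<omega>)) (x, y) = mass X x * mass Y y"
      using X Y XY HY by (intro mass_Pair_if_entropy_additive) simp_all
    also have "mass (\<lambda>\<omega>. (X \<omega>, Y \<omega>)) (x, y)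
        = (\<Sum>t | t \<in> ?S \<and> (\<lambda>(x, y, z). (x, y)) t = (x, y). mass ?T t)"
      using mass_comp[OF T fS, of "\<lambda>(x, y, z). (x, y)" "(x, y)"] by simp
    finally have "(\<Sum>t | t \<in> ?S \<and> (\<lambda>(x, y, z). (x, y)) t = (x, y). mass ?T t) \<noteq> 0"
      using that by simp
    \<comment> \<open>The positive mass of \<open>(x, y)\<close> is a sum of masses of triples over
      it, so one of these is nonzero.\<close>
    then obtain z where z: "mass ?T (x, y, z) \<noteq> 0"
      by (elim sum.not_neutral_contains_not_neutral) auto
    have "mass (\<lambda>\<omega>. (X \<omega>, Z \<omega>)) (x, z) = mass X x * mass Z z"
      using X Z XZ HZ by (intro mass_Pair_if_entropy_additive) simp_all
    moreover have "mass (\<lambda>\<omega>. (Y \<omega>, Z \<omega>)) (y, z) = mass Y y * mass Z z"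
      using Y Z YZ HY HZ by (intro mass_Pair_if_entropy_additive) simp_all
    \<comment> \<open>The pair has the same entropy as the triple, so no other triple of positive
      mass projects to \<open>(x, z)\<close>.\<close>
    moreover have "mass (\<lambda>\<omega>. (X \<omega>, Z \<omega>)) (x, z) = mass ?T (x, y, z)"
      using mass_eq_if_entropy_comp_eq[OF T _ z, of "\<lambda>(x, y, z). (x, z)"] XYZ XZ by simp
    moreover have "mass (\<lambda>\<omega>. (Y \<omega>, Z \<omega>)) (y, z) = mass ?T (x, y, z)"
      using mass_eq_if_entropy_comp_eq[OF T _ z, of "\<lambda>(x, y, z). (y, z)"] XYZ YZ by simp
    ultimately have "mass X x * mass Z z = mass Y y * mass Z z" "mass Z z \<noteq> 0"
      using z by (simp_all only:) auto
    then show ?thesis by (simp only: mult_cancel_right) blast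
  qed
  have sumY: "(\<Sum>y\<in>Y ` space M. mass Y y) = 1"
    using sum_mass[OF Y] simple_functionD(1)[OF Y] by simp
  then obtain y where y: "mass Y y \<noteq> 0"
    using sum.not_neutral_contains_not_neutral[of "mass Y" "Y ` space M"] by auto
  have fX: "finite (X ` space M)" by (rule simple_functionD(1)[OF X])
  \<comment> \<open>The range may contain values of probability 0, hence the restriction to the
    support. Every mass there equals that of the one fixed \<open>y\<close>.\<close>
  let ?S = "{x \<in> X ` space M. mass X x \<noteq> 0}"
  have "1 = (\<Sum>x\<in>X ` space M. mass X x)"
    using sum_mass[OF X fX] by simp
  also have "\<dots> = (\<Sum>x\<in>?S. mass X x)"
    using fX by (intro sum.mono_neutral_right) auto
  also have "\<dots> = (\<Sum>x\<in>?S. mass Y y)"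
    using same y by (intro sum.cong) auto
  finally have card: "real (card ?S) * mass Y y = 1" by simp
  then have "card ?S \<ge> 1"
    by (cases "card ?S") auto
  moreover have "\<H>(X) = - log b (mass Y y)"
    using same y by (intro entropy_constant_mass[OF X]) auto
  moreover have "mass Y y = inverse (real (card ?S))"
    by (rule inverse_unique[OF card, symmetric])
  ultimately have "\<H>(X) = log b (real (card ?S))"
    by (simp add: log_inverse)
  with \<open>card ?S \<ge> 1\<close> show ?thesis by blast
qed

end

section \<open>Necessity: from the rank function to three variables\<close>

lemma entropic_U25_hat_imp_log:
  assumes ijkl: "N4 = {i, j, k, l}" "distinct [i, j, k, l]"
    and ent: "entropic (\<lambda>A. a * real (U25_hat_rank i A))"
  shows "\<exists>n\<ge>1. a = log 2 (real n)"
proof -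
  obtain M :: "nat measure" and X :: "nat \<Rightarrow> nat \<Rightarrow> nat"
    where fin: "finite_random_vector M X"
      and h: "\<And>A. A \<subseteq> N4 \<Longrightarrow> a * real (U25_hat_rank i A) = entropy_function M X A"
    using ent unfolding entropic_def by blast
  interpret information_space M 2
    using fin by (simp add: information_space_def information_space_axioms_def finite_random_vector_def)
  have s: "simple_function M (X m)" if "m \<in> N4" for m
    using fin that by (simp add: finite_random_vector_def)
  \<comment> \<open>Subvectors are functions on \<open>A\<close>, whereas the criterion speaks of
    tuples. The injection \<open>f\<close> recodes one as the other, which preserves
    entropy.\<close>
  have via: "entropy_Pow (T) = a * real (U25_hat_rank i A)"
    if A: "A \<subseteq> N4" and T: "simple_function M T" and f: "inj f"
      and eq: "subvector X A = f \<circ> T" for A f and T :: "nat \<Rightarrow> 'z"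
    using h[OF A] entropy_of_inj[OF T inj_on_subset[OF f]]
    by (simp add: entropy_function_def eq)
  have H1: "entropy_Pow (X m) = a" if "m \<in> N4" "m \<noteq> i" for m
  proof -
    have "entropy_Pow (X m) = a * real (U25_hat_rank i {m})"
    proof (rule via[OF _ s])
      show "inj (\<lambda>x. \<lambda>n\<in>{m}. x)"
        by (rule injI) (metis restrict_apply' singletonI)
    qed (use that in \<open>auto simp: subvector_def fun_eq_iff\<close>)
    then show ?thesis using that by (simp add: U25_hat_rank_def)
  qed
  have H2: "entropy_Pow (\<lambda>\<omega>. (X m \<omega>, X n \<omega>)) = 2 * a" if "m \<in> N4" "n \<in> N4" "m \<noteq> n" for m n
  proof -
    have "entropy_Pow (\<lambda>\<omega>. (X m \<omega>, X n \<omega>)) = a * real (U25_hat_rank i {m, n})"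
    proof (rule via)
      show "inj (\<lambda>(x, y). \<lambda>p\<in>{m, n}. if p = m then x else y)" (is "inj ?f")
      proof (rule injI)
        fix u v assume eq: "?f u = ?f v"
        show "u = v"
          using fun_cong[OF eq, of m] fun_cong[OF eq, of n] that by (cases u; cases v) simp
      qed
    qed (use that s in \<open>auto simp: subvector_def fun_eq_iff intro!: simple_function_Pair\<close>)
    moreover have "{m, n} \<noteq> {i}" using that by auto
    ultimately show ?thesis using that by (simp add: U25_hat_rank_def)
  qed
  have H3: "entropy_Pow (\<lambda>\<omega>. (X j \<omega>, X k \<omega>, X l \<omega>)) = 2 * a"
  proof -
    have "entropy_Pow (\<lambda>\<omega>. (X j \<omega>, X k \<omega>, X l \<omega>)) = a * real (U25_hat_rank i {j, k, l})"
    proof (rule via)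
      show "inj (\<lambda>(x, y, z). \<lambda>p\<in>{j, k, l}. if p = j then x else if p = k then y else z)"
        (is "inj ?f")
      proof (rule injI)
        fix u v assume eq: "?f u = ?f v"
        show "u = v"
          using fun_cong[OF eq, of j] fun_cong[OF eq, of k] fun_cong[OF eq, of l] ijkl(2)
          by (cases u; cases v) simp
      qed
    qed (use ijkl s in \<open>auto simp: subvector_def fun_eq_iff intro!: simple_function_Pair\<close>)
    moreover have "{j, k, l} \<noteq> {i}" using ijkl by auto
    ultimately show ?thesis using ijkl by (simp add: U25_hat_rank_def)
  qed
  have jkl: "j \<in> N4" "k \<in> N4" "l \<in> N4" "j \<noteq> i" "k \<noteq> i" "l \<noteq> i" "j \<noteq> k" "j \<noteq> l" "k \<noteq> l"
    using ijkl by auto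
  have "\<exists>n\<ge>1. entropy_Pow (X j) = log 2 (real n)"
  proof (rule entropy_eq_log_nat[where Y = "X k" and Z = "X l"])
  qed (simp_all add: jkl s H1 H2 H3)
  then show ?thesis by (simp add: jkl H1)
qed

section \<open>Construction\<close>

lemma add_mod_left_cancel_less:
  fixes a :: nat
  assumes "b < n" "b' < n" "(a + b) mod n = (a + b') mod n"
  shows "b = b'"
proof -
  have "b mod n = b' mod n"
    using assms(3) by (simp add: nat_mod_eq_iff)
  then show ?thesis using assms(1,2) by simp
qed

text \<open>On \<open>n^2\<close> equally likely points, each subvector is uniform: its fibres have
  \<open>n^(2 - r)\<close> points, where \<open>r\<close> is the rank of the index set. So its
  entropy is \<open>r * log 2 n\<close>.\<close>

lemma entropic_U25_hat_log:
  assumes ijkl: "N4 = {i, j, k, l}" "distinct [i, j, k, l]" and n: "n \<ge> 1"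
  shows "entropic (\<lambda>A. log 2 (real n) * real (U25_hat_rank i A))"
proof -
  define \<Omega> where "\<Omega> = {..<n} \<times> {..<n}"
  define M where "M = uniform_count_measure \<Omega>"
  \<comment> \<open>All coordinates share one alphabet type, so the pair \<open>(a, b)\<close> at
    index \<open>i\<close> is coded as the number \<open>a * n + b\<close>, which is injective
    because \<open>b < n\<close>.\<close>
  define X where "X = (\<lambda>m (a, b). if m = j then a else if m = k then b
    else if m = l then (a + b) mod n else a * n + b)"
  have fin: "finite \<Omega>" and ne: "\<Omega> \<noteq> {}" and card: "card \<Omega> = n ^ 2"
    using n by (auto simp: \<Omega>_def power2_eq_square lessThan_empty_iff)
  interpret prob_space M
    unfolding M_def using fin ne by (rule prob_space_uniform_count_measure)
  interpret information_space M 2 by standard simp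
  have space: "space M = \<Omega>" and sets: "sets M = Pow \<Omega>"
    by (simp_all add: M_def space_uniform_count_measure sets_uniform_count_measure)
  have prob: "prob A = card A / n ^ 2" if "A \<subseteq> \<Omega>" for A
    using measure_uniform_count_measure[OF fin that] by (simp add: M_def card)
  have simple: "simple_function M f" for f :: "nat \<times> nat \<Rightarrow> 'z"
    using fin by (auto simp: simple_function_def space sets)
  have X: "finite_random_vector M X"
    by (simp add: finite_random_vector_def simple prob_space_axioms)
  have inj_i: "inj_on (X i) \<Omega>"
  proof (rule inj_onI, clarify)
    fix a b a' b' assume *: "(a, b) \<in> \<Omega>" "(a', b') \<in> \<Omega>" "X i (a, b) = X i (a', b')"
    then have "b < n" "b' < n" "a * n + b = a' * n + b'"
      using ijkl by (auto simp: X_def \<Omega>_def)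
    moreover have "a = (a * n + b) div n" "b = (a * n + b) mod n" if "b < n" for a b
      using that by auto
    ultimately show "a = a' \<and> b = b'" by metis
  qed
  \<comment> \<open>Coordinate \<open>i\<close> alone already determines the point. Among the other
    three, any two of \<open>a\<close>, \<open>b\<close> and \<open>(a + b) mod n\<close> determine
    \<open>a\<close> and \<open>b\<close>.\<close>
  have inj2: "inj_on (\<lambda>\<omega>. (X m \<omega>, X m' \<omega>)) \<Omega>" if "m \<in> N4" "m' \<in> N4" "m \<noteq> m'" for m m'
  proof (cases "m = i \<or> m' = i")
    case True
    then show ?thesis using inj_i by (auto simp: inj_on_def)
  next
    case False
    show ?thesis
    proof (rule inj_onI, clarify)
      fix a b a' b' assume *: "(a, b) \<in> \<Omega>" "(a', b') \<in> \<Omega>"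
        "X m (a, b) = X m (a', b')" "X m' (a, b) = X m' (a', b')"
      then have "a < n" "b < n" "a' < n" "b' < n" by (auto simp: \<Omega>_def)
      then have mod: "a = a' \<Longrightarrow> (a + b) mod n = (a' + b') mod n \<Longrightarrow> b = b'"
        "b = b' \<Longrightarrow> (a + b) mod n = (a' + b') mod n \<Longrightarrow> a = a'"
        using add_mod_left_cancel_less[of b n b' a] add_mod_left_cancel_less[of a n a' b]
        by (simp_all add: add.commute)
      have Xjkl: "X j (a, b) = a" "X k (a, b) = b" "X l (a, b) = (a + b) mod n" for a b
        using ijkl by (auto simp: X_def)
      have "m = j \<or> m = k \<or> m = l" "m' = j \<or> m' = k \<or> m' = l"
        using that False ijkl by auto
      then show "a = a' \<and> b = b'"
        using *(3,4) \<open>m \<noteq> m'\<close> mod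
        by (elim disjE) (simp_all add: Xjkl)
    qed
  qed
  have "log 2 (real n) * real (U25_hat_rank i A) = entropy_function M X A" if A: "A \<subseteq> N4" for A
  proof -
    let ?r = "U25_hat_rank i A" and ?T = "subvector X A"
    have "mass ?T t = (1 / real n) ^ ?r" if t: "t \<in> ?T ` space M" for t
    proof -
      obtain \<omega> where \<omega>: "\<omega> \<in> \<Omega>" "t = ?T \<omega>" using t by (auto simp: space)
      have full: "mass ?T t = (1 / real n) ^ 2" if inj: "inj_on ?T \<Omega>"
      proof -
        have "{\<omega> \<in> space M. ?T \<omega> = t} = {\<omega>}"
          using \<omega> inj by (auto simp: space dest: inj_onD)
        then show ?thesis using \<omega> by (simp add: prob power_divide)
      qed
      have T: "?T u = ?T v \<longleftrightarrow> (\<forall>m\<in>A. X m u = X m v)" for u v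
        by (auto simp: subvector_def fun_eq_iff restrict_def)
      \<comment> \<open>The ranks in these cases are 0, 2, 1 and 2. The last case covers every set
        with at least two elements.\<close>
      consider "A = {}" | "A = {i}" | m where "A = {m}" "m \<noteq> i"
        | m m' where "m \<in> A" "m' \<in> A" "m \<noteq> m'"
      proof (cases "A = {}")
        case False
        then obtain m where m: "m \<in> A" by blast
        show thesis
        proof (cases "A = {m}")
          case True
          then show thesis using that(2,3) by (cases "m = i") simp_all
        next
          case False
          with m obtain m' where "m' \<in> A" "m \<noteq> m'" by blast
          with m show thesis by (rule that(4))
        qed
      qed (rule that(1))
      then show ?thesis
      proof cases
        case 1
        then have "?T u = t" for u unfolding \<omega>(2) by (subst T) simp
        then have "{\<omega> \<in> space M. ?T \<omega> = t} = space M" by simp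
        then show ?thesis using 1 by (simp add: U25_hat_rank_def prob_space)
      next
        case 2
        then have "inj_on ?T \<Omega>" using inj_i unfolding inj_on_def T by simp
        then show ?thesis using full 2 by (simp add: U25_hat_rank_def)
      next
        case 3
        then have m: "m \<in> {j, k, l}" using A ijkl by auto
        \<comment> \<open>The companion index avoids \<open>i\<close> so that both coordinates stay
          below \<open>n\<close> and the pair maps \<Omega> to itself.\<close>
        have "\<exists>m'\<in>{j, k, l}. m' \<noteq> m" using ijkl(2) by auto
        then obtain m' where m': "m' \<in> {j, k, l}" "m' \<noteq> m" by blast
        let ?f = "\<lambda>\<omega>. (X m \<omega>, X m' \<omega>)"
        have less: "X p \<omega> < n" if "p \<in> {j, k, l}" "\<omega> \<in> \<Omega>" for p \<omega>
          using that n by (auto simp: X_def \<Omega>_def)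
        have inj: "inj_on ?f \<Omega>" using inj2[of m m'] m m' ijkl by auto
        moreover have "?f ` \<Omega> \<subseteq> \<Omega>"
          using less[OF m] less[OF m'(1)] unfolding \<Omega>_def by blast
        ultimately have surj: "?f ` \<Omega> = \<Omega>"
          using fin by (simp add: endo_inj_surj)
        txt \<open>Since \<open>(X m, X m')\<close> permutes \<open>\<Omega>\<close>, the fibre of \<open>X m\<close> is as large as that of \<open>fst\<close>.\<close>
        have "?f ` {\<omega>' \<in> \<Omega>. X m \<omega>' = X m \<omega>} = {X m \<omega>} \<times> {..<n}" (is "?f ` ?F = ?R")
        proof
          show "?f ` ?F \<subseteq> ?R" using less[OF m'(1)] by auto
          show "?R \<subseteq> ?f ` ?F"
          proof
            fix q assume q: "q \<in> ?R"
            then have "q \<in> \<Omega>" using less[OF m \<omega>(1)] by (auto simp: \<Omega>_def)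
            then obtain \<omega>' where "\<omega>' \<in> \<Omega>" "q = ?f \<omega>'" using surj by blast
            with q show "q \<in> ?f ` ?F" by auto
          qed
        qed
        moreover have "inj_on ?f ?F" using inj by (rule inj_on_subset) auto
        ultimately have "card ?F = n" using card_image[of ?f ?F] by simp
        moreover have "{\<omega> \<in> space M. ?T \<omega> = t} = ?F"
          using 3 unfolding \<omega>(2) T by (simp add: space)
        ultimately have "mass ?T t = real n / n ^ 2" by (simp add: prob)
        then show ?thesis using 3 n by (simp add: U25_hat_rank_def power2_eq_square)
      next
        case 4
        then have "inj_on ?T \<Omega>"
          using inj2[of m m'] A unfolding inj_on_def T by blast
        moreover have "2 \<le> card A"
        proof -
          have "card {m, m'} \<le> card A"
            using 4 A finite_N4 finite_subset by (intro card_mono) auto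
          then show ?thesis using 4 by simp
        qed
        ultimately show ?thesis using full by (simp add: U25_hat_rank_def)
      qed
    qed
    then have "entropy_function M X A = - log 2 ((1 / real n) ^ ?r)"
      unfolding entropy_function_def by (intro entropy_constant_mass simple)
    also have "\<dots> = log 2 (real n) * real ?r"
      using n by (simp add: log_nat_power log_divide)
    finally show ?thesis ..
  qed
  with X show ?thesis by (rule entropicI)
qed

theorem mainTheorem1:
  fixes i :: nat and a :: real
  assumes "i \<in> N4" and "a \<ge> 0"
  shows "entropic (\<lambda>A. a * real (U25_hat_rank i A)) \<longleftrightarrow>
    (\<exists>v :: int. v \<ge> 1 \<and> a = log 2 (real_of_int v))"
proof -
  \<comment> \<open>The rank function is symmetric in the three elements other than
    \<open>i\<close>, so they may be named in any order.\<close>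
  obtain j k l where ijkl: "N4 = {i, j, k, l}" "distinct [i, j, k, l]"
  proof -
    have "card (N4 - {i}) = 3"
      using \<open>i \<in> N4\<close> by (auto simp: N4_def)
    then obtain j k l where "N4 - {i} = {j, k, l}" "j \<noteq> k" "k \<noteq> l" "j \<noteq> l"
      by (auto simp: card_3_iff)
    with \<open>i \<in> N4\<close> show thesis by (intro that[of j k l]) auto
  qed
  show ?thesis
  proof
    assume "entropic (\<lambda>A. a * real (U25_hat_rank i A))"
    then obtain n :: nat where "n \<ge> 1" "a = log 2 (real n)"
      using entropic_U25_hat_imp_log[OF ijkl] by blast
    then show "\<exists>v :: int. v \<ge> 1 \<and> a = log 2 (real_of_int v)"
      by (intro exI[of _ "int n"]) simp
  next
    assume "\<exists>v :: int. v \<ge> 1 \<and> a = log 2 (real_of_int v)"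
    then obtain v :: int where "v \<ge> 1" "a = log 2 (real_of_int v)" by blast
    then show "entropic (\<lambda>A. a * real (U25_hat_rank i A))"
      using entropic_U25_hat_log[OF ijkl, of "nat v"] by simp
  qed
qed

end
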